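(* Let $T$ be the set of all sentences in the language of ordered rings $(+,-,\cdot,\le,0,1)$ that are true in the ordered ring of integers $\mathbb{Z}$ and have the form $\forall x_1\forall x_2\ldots\forall x_n\exists y\,\phi$, where $\phi$ is an open (quantifier-free) formula. Then $T$ axiomatizes $DOI$: a structure in this language is a model of $T$ if and only if it is a model of $DOI$.
   Context: All formulas are in the language of ordered rings with signature $(+,-,\cdot,\le,0,1)$. A discretely ordered ring is an ordered (commutative, unital) ring with no element strictly between $0$ and $1$. A model of open induction ($OI$) is a discretely ordered ring whose semiring of non-negative elements satisfies the induction axioms for all open (quantifier-free) formulas (with parameters). An ordered ring is diophantine correct if it satisfies every universal sentence (of this language) true in the ordered ring of integers. $DOI$ denotes the theory of diophantine correct models of open induction, i.e. $OI$ together with all universal sentences true in $\mathbb{Z}$. *)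

theory Defs
  imports "HOL-Algebra.Ring"
begin

section \<open>First-order logic over the language of ordered rings\<close>

text \<open>The symbol \<open>-\<close> of the signature is read as binary subtraction.\<close>

datatype tm =
    Var nat
  | Zero
  | One
  | Add tm tm
  | Sub tm tm
  | Mul tm tm

datatype fm =
    Eq tm tm
  | Le tm tm
  | Neg fm
  | Conj fm fm
  | Disj fm fm
  | Forall nat fm
  | Exists nat fm

primrec tm_vars :: "tm \<Rightarrow> nat set" where
  "tm_vars (Var i) = {i}"
| "tm_vars Zero = {}"
| "tm_vars One = {}"
| "tm_vars (Add s t) = tm_vars s \<union> tm_vars t"
| "tm_vars (Sub s t) = tm_vars s \<union> tm_vars t"
| "tm_vars (Mul s t) = tm_vars s \<union> tm_vars t"

primrec free_vars :: "fm \<Rightarrow> nat set" where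
  "free_vars (Eq s t) = tm_vars s \<union> tm_vars t"
| "free_vars (Le s t) = tm_vars s \<union> tm_vars t"
| "free_vars (Neg p) = free_vars p"
| "free_vars (Conj p q) = free_vars p \<union> free_vars q"
| "free_vars (Disj p q) = free_vars p \<union> free_vars q"
| "free_vars (Forall i p) = free_vars p - {i}"
| "free_vars (Exists i p) = free_vars p - {i}"

definition sentence :: "fm \<Rightarrow> bool" where
  "sentence p \<longleftrightarrow> free_vars p = {}"

primrec open_fm :: "fm \<Rightarrow> bool" where
  "open_fm (Eq s t) \<longleftrightarrow> True"
| "open_fm (Le s t) \<longleftrightarrow> True"
| "open_fm (Neg p) \<longleftrightarrow> open_fm p"
| "open_fm (Conj p q) \<longleftrightarrow> open_fm p \<and> open_fm q"
| "open_fm (Disj p q) \<longleftrightarrow> open_fm p \<and> open_fm q"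
| "open_fm (Forall i p) \<longleftrightarrow> False"
| "open_fm (Exists i p) \<longleftrightarrow> False"

definition universal_sentence :: "fm \<Rightarrow> bool" where
  "universal_sentence s \<longleftrightarrow>
     sentence s \<and> (\<exists>xs p. open_fm p \<and> distinct xs \<and> s = foldr Forall xs p)"

definition forall_exists1_sentence :: "fm \<Rightarrow> bool" where
  "forall_exists1_sentence s \<longleftrightarrow>
     sentence s \<and>
     (\<exists>xs y p. open_fm p \<and> distinct (xs @ [y]) \<and> s = foldr Forall xs (Exists y p))"


section \<open>Structures and satisfaction\<close>

text \<open>
  The operations and the order of a structure are arbitrary; in particular \<open>sub\<close> need not be
  the subtraction that HOL-Algebra derives from addition.
\<close>

record 'a oring_struct = "'a ring" +
  sub :: "'a \<Rightarrow> 'a \<Rightarrow> 'a"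
  leq :: "'a \<Rightarrow> 'a \<Rightarrow> bool"

definition is_structure :: "'a oring_struct \<Rightarrow> bool" where
  "is_structure M \<longleftrightarrow>
     \<zero>\<^bsub>M\<^esub> \<in> carrier M \<and> \<one>\<^bsub>M\<^esub> \<in> carrier M \<and>
     (\<forall>a\<in>carrier M. \<forall>b\<in>carrier M.
        a \<oplus>\<^bsub>M\<^esub> b \<in> carrier M \<and> sub M a b \<in> carrier M \<and> a \<otimes>\<^bsub>M\<^esub> b \<in> carrier M)"

primrec tm_val :: "'a oring_struct \<Rightarrow> (nat \<Rightarrow> 'a) \<Rightarrow> tm \<Rightarrow> 'a" where
  "tm_val M v (Var i) = v i"
| "tm_val M v Zero = \<zero>\<^bsub>M\<^esub>"
| "tm_val M v One = \<one>\<^bsub>M\<^esub>"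
| "tm_val M v (Add s t) = tm_val M v s \<oplus>\<^bsub>M\<^esub> tm_val M v t"
| "tm_val M v (Sub s t) = sub M (tm_val M v s) (tm_val M v t)"
| "tm_val M v (Mul s t) = tm_val M v s \<otimes>\<^bsub>M\<^esub> tm_val M v t"

primrec sat :: "'a oring_struct \<Rightarrow> (nat \<Rightarrow> 'a) \<Rightarrow> fm \<Rightarrow> bool" where
  "sat M v (Eq s t) \<longleftrightarrow> tm_val M v s = tm_val M v t"
| "sat M v (Le s t) \<longleftrightarrow> leq M (tm_val M v s) (tm_val M v t)"
| "sat M v (Neg p) \<longleftrightarrow> \<not> sat M v p"
| "sat M v (Conj p q) \<longleftrightarrow> sat M v p \<and> sat M v q"
| "sat M v (Disj p q) \<longleftrightarrow> sat M v p \<or> sat M v q"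
| "sat M v (Forall i p) \<longleftrightarrow> (\<forall>a\<in>carrier M. sat M (v(i := a)) p)"
| "sat M v (Exists i p) \<longleftrightarrow> (\<exists>a\<in>carrier M. sat M (v(i := a)) p)"

definition true_in :: "'a oring_struct \<Rightarrow> fm \<Rightarrow> bool" where
  "true_in M s \<longleftrightarrow> (\<forall>v. range v \<subseteq> carrier M \<longrightarrow> sat M v s)"

definition is_model :: "'a oring_struct \<Rightarrow> fm set \<Rightarrow> bool" where
  "is_model M S \<longleftrightarrow> (\<forall>s\<in>S. true_in M s)"

definition int_struct :: "int oring_struct" where
  "int_struct = \<lparr>carrier = UNIV, mult = (*), one = 1, zero = 0, add = (+),
                 sub = (-), leq = (\<le>)\<rparr>"


section \<open>Diophantine correct open induction\<close>

definition ordered_ring :: "'a oring_struct \<Rightarrow> bool" where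
  "ordered_ring M \<longleftrightarrow>
     cring M \<and> \<zero>\<^bsub>M\<^esub> \<noteq> \<one>\<^bsub>M\<^esub> \<and>
     (\<forall>a\<in>carrier M. \<forall>b\<in>carrier M. sub M a b = a \<ominus>\<^bsub>M\<^esub> b) \<and>
     linear_order_on (carrier M) {(a, b). a \<in> carrier M \<and> b \<in> carrier M \<and> leq M a b} \<and>
     (\<forall>a\<in>carrier M. \<forall>b\<in>carrier M. \<forall>c\<in>carrier M.
        leq M a b \<longrightarrow> leq M (a \<oplus>\<^bsub>M\<^esub> c) (b \<oplus>\<^bsub>M\<^esub> c)) \<and>
     (\<forall>a\<in>carrier M. \<forall>b\<in>carrier M.
        leq M \<zero>\<^bsub>M\<^esub> a \<and> leq M \<zero>\<^bsub>M\<^esub> b \<longrightarrow> leq M \<zero>\<^bsub>M\<^esub> (a \<otimes>\<^bsub>M\<^esub> b))"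

definition discretely_ordered_ring :: "'a oring_struct \<Rightarrow> bool" where
  "discretely_ordered_ring M \<longleftrightarrow>
     ordered_ring M \<and>
     \<not> (\<exists>a\<in>carrier M. leq M \<zero>\<^bsub>M\<^esub> a \<and> a \<noteq> \<zero>\<^bsub>M\<^esub> \<and> leq M a \<one>\<^bsub>M\<^esub> \<and> a \<noteq> \<one>\<^bsub>M\<^esub>)"

text \<open>
  Induction in the variable \<open>x\<close> over the non-negative elements.  The assignment \<open>v\<close> supplies the
  parameters, which may be any elements of the ring.  In an ordered ring, allowing only
  non-negative parameters, or only formulas without \<open>-\<close>, gives the same notion: every element is
  a difference of two non-negative ones, and subtracted terms can be moved across \<open>=\<close> and \<open>\<le>\<close>.
\<close>

definition open_induction :: "'a oring_struct \<Rightarrow> bool" where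
  "open_induction M \<longleftrightarrow>
     (\<forall>p v x. open_fm p \<and> range v \<subseteq> carrier M \<longrightarrow>
        sat M (v(x := \<zero>\<^bsub>M\<^esub>)) p \<and>
        (\<forall>a\<in>carrier M. leq M \<zero>\<^bsub>M\<^esub> a \<and> sat M (v(x := a)) p \<longrightarrow>
           sat M (v(x := a \<oplus>\<^bsub>M\<^esub> \<one>\<^bsub>M\<^esub>)) p) \<longrightarrow>
        (\<forall>a\<in>carrier M. leq M \<zero>\<^bsub>M\<^esub> a \<longrightarrow> sat M (v(x := a)) p))"

definition model_OI :: "'a oring_struct \<Rightarrow> bool" where
  "model_OI M \<longleftrightarrow> discretely_ordered_ring M \<and> open_induction M"

definition diophantine_correct :: "'a oring_struct \<Rightarrow> bool" where
  "diophantine_correct M \<longleftrightarrow>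
     ordered_ring M \<and>
     (\<forall>s. universal_sentence s \<and> true_in int_struct s \<longrightarrow> true_in M s)"

definition model_DOI :: "'a oring_struct \<Rightarrow> bool" where
  "model_DOI M \<longleftrightarrow> model_OI M \<and> diophantine_correct M"

definition T :: "fm set" where
  "T = {s. forall_exists1_sentence s \<and> true_in int_struct s}"

end

theory Submission
  imports Defs
begin

text \<open>
  From \<open>T\<close> to \<open>DOI\<close>: a universal sentence becomes a \<open>\<forall>\<exists>\<close>-sentence with a dummy existential
  variable, and induction for \<open>p\<close> says that if \<open>p\<close> holds at \<open>0\<close> but not at some \<open>b \<ge> 0\<close>, then
  there is a single \<open>y \<ge> 0\<close> with \<open>p y\<close> and not \<open>p (y + 1)\<close>.

  From \<open>DOI\<close> to \<open>T\<close>, no real closure is needed. Write the atoms of an open formula in \<open>y\<close> as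
  \<open>0 \<le> t\<close>. Where the forward difference of \<open>t\<close> has constant sign, \<open>t\<close> is monotone by open
  induction, so by induction on the degree \<open>t\<close> changes sign only finitely often on the
  non-negative part of \<open>M\<close>. Diophantine correctness copies into the integers the parameters,
  the finitely many points next to sign changes of iterated differences of the atoms, and the
  signs there. Between consecutive copied points the signs are constant again: the last
  difference vanishes, and each earlier one is monotone by the sign of its successor, with
  known signs at both ends. Beyond the last point, growth in \<open>M\<close> forces each nonzero difference
  to pass on its sign. So an integer solution \<open>y\<close> may be moved to a copied point, and the
  original of that point is a solution in \<open>M\<close>.
\<close>

section \<open>Syntax and transfer of open formulas\<close>

abbreviation Imp :: "fm \<Rightarrow> fm \<Rightarrow> fm" where
  "Imp p q \<equiv> Disj (Neg p) q"

lemma int_struct_simps [simp]: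
  "carrier int_struct = UNIV" "\<zero>\<^bsub>int_struct\<^esub> = 0" "\<one>\<^bsub>int_struct\<^esub> = 1"
  "a \<oplus>\<^bsub>int_struct\<^esub> b = a + b" "a \<otimes>\<^bsub>int_struct\<^esub> b = a * b"
  "sub int_struct a b = a - b" "leq int_struct a b \<longleftrightarrow> a \<le> b"
  by (simp_all add: int_struct_def)

lemma finite_tm_vars [simp]: "finite (tm_vars t)"
  by (induction t) auto

lemma finite_free_vars [simp]: "finite (free_vars p)"
  by (induction p) auto

lemma tm_val_cong: "(\<And>i. i \<in> tm_vars t \<Longrightarrow> v i = w i) \<Longrightarrow> tm_val M v t = tm_val M w t"
  by (induction t) auto

lemma sat_cong:
  "open_fm p \<Longrightarrow> (\<And>i. i \<in> free_vars p \<Longrightarrow> v i = w i) \<Longrightarrow> sat M v p \<longleftrightarrow> sat M w p"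
proof (induction p)
  case (Eq s t)
  then show ?case using tm_val_cong[of s v w M] tm_val_cong[of t v w M] by auto
next
  case (Le s t)
  then show ?case using tm_val_cong[of s v w M] tm_val_cong[of t v w M] by auto
qed auto

primrec tsubst :: "nat \<Rightarrow> tm \<Rightarrow> tm \<Rightarrow> tm" where
  "tsubst x s (Var i) = (if i = x then s else Var i)"
| "tsubst x s Zero = Zero"
| "tsubst x s One = One"
| "tsubst x s (Add t u) = Add (tsubst x s t) (tsubst x s u)"
| "tsubst x s (Sub t u) = Sub (tsubst x s t) (tsubst x s u)"
| "tsubst x s (Mul t u) = Mul (tsubst x s t) (tsubst x s u)"

text \<open>Only used for open formulas; quantified formulas are left alone.\<close>

primrec fsubst :: "nat \<Rightarrow> tm \<Rightarrow> fm \<Rightarrow> fm" where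
  "fsubst x s (Eq t u) = Eq (tsubst x s t) (tsubst x s u)"
| "fsubst x s (Le t u) = Le (tsubst x s t) (tsubst x s u)"
| "fsubst x s (Neg p) = Neg (fsubst x s p)"
| "fsubst x s (Conj p q) = Conj (fsubst x s p) (fsubst x s q)"
| "fsubst x s (Disj p q) = Disj (fsubst x s p) (fsubst x s q)"
| "fsubst x s (Forall i p) = Forall i p"
| "fsubst x s (Exists i p) = Exists i p"

lemma tm_val_tsubst [simp]: "tm_val M v (tsubst x s t) = tm_val M (v(x := tm_val M v s)) t"
  by (induction t) auto

lemma sat_fsubst [simp]:
  "open_fm p \<Longrightarrow> sat M v (fsubst x s p) \<longleftrightarrow> sat M (v(x := tm_val M v s)) p"
  by (induction p) auto

lemma open_fm_fsubst [simp]: "open_fm (fsubst x s p) \<longleftrightarrow> open_fm p"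
  by (induction p) auto

text \<open>Truth means satisfaction under every assignment, and \<open>v\<close> equals
  \<open>v(i := v i)\<close>, so a universal prefix may be added or dropped at will.\<close>

lemma true_in_Forall:
  fixes M :: "'a oring_struct"
  shows "true_in M (Forall i p) \<longleftrightarrow> true_in M p"
proof
  assume F: "true_in M (Forall i p)"
  show "true_in M p"
    unfolding true_in_def
  proof (intro allI impI)
    fix v :: "nat \<Rightarrow> 'a" assume v: "range v \<subseteq> carrier M"
    then have "sat M v (Forall i p)" "v i \<in> carrier M"
      using F by (auto simp: true_in_def)
    then have "sat M (v(i := v i)) p" unfolding sat.simps by blast
    then show "sat M v p" by simp
  qed
next
  assume p: "true_in M p"
  have "range (v(i := a)) \<subseteq> carrier M" if "range v \<subseteq> carrier M" "a \<in> carrier M" for v a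
    using that by auto
  then show "true_in M (Forall i p)"
    using p by (simp add: true_in_def)
qed

lemma true_in_Foralls: "true_in M (foldr Forall xs p) \<longleftrightarrow> true_in M p"
  by (induction xs) (auto simp: true_in_Forall)

lemma free_vars_Foralls: "free_vars (foldr Forall xs p) = free_vars p - set xs"
  by (induction xs) auto

text \<open>Closing an open formula over its free variables gives a universal sentence, so only open
  formulas need be considered.\<close>

lemma diophantine_correct_iff:
  "diophantine_correct M \<longleftrightarrow>
     ordered_ring M \<and> (\<forall>p. open_fm p \<and> true_in int_struct p \<longrightarrow> true_in M p)"
proof -
  have "universal_sentence (foldr Forall (sorted_list_of_set (free_vars p)) p)" if "open_fm p" for p
    using that unfolding universal_sentence_def sentence_def
    by (auto simp: free_vars_Foralls intro!: exI[of _ "sorted_list_of_set (free_vars p)"])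
  then show ?thesis
    unfolding diophantine_correct_def
    by (metis true_in_Foralls universal_sentence_def)
qed

text \<open>Here the prefix closes over the free variables other than \<open>y\<close>, which keeps
  it distinct from the existential variable.\<close>

lemma is_model_T_iff:
  "is_model M T \<longleftrightarrow>
     (\<forall>y p. open_fm p \<and> true_in int_struct (Exists y p) \<longrightarrow> true_in M (Exists y p))"
proof -
  have "forall_exists1_sentence
          (foldr Forall (sorted_list_of_set (free_vars p - {y})) (Exists y p))"
    if "open_fm p" for p y
    using that unfolding forall_exists1_sentence_def sentence_def
    by (auto simp: free_vars_Foralls
        intro!: exI[of _ "sorted_list_of_set (free_vars p - {y})"] exI[of _ y])
  then show ?thesis
    unfolding is_model_def T_def mem_Collect_eq Ball_def
    by (metis true_in_Foralls forall_exists1_sentence_def)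
qed

section \<open>Ring and order laws from universal correctness\<close>

locale universally_correct =
  fixes M :: "'a oring_struct"
  assumes is_structure: "is_structure M"
    and correct: "open_fm p \<Longrightarrow> true_in int_struct p \<Longrightarrow> true_in M p"
begin

abbreviation "zer \<equiv> \<zero>\<^bsub>M\<^esub>"
abbreviation "uno \<equiv> \<one>\<^bsub>M\<^esub>"
abbreviation pls (infixl \<open>+.\<close> 65) where "a +. b \<equiv> a \<oplus>\<^bsub>M\<^esub> b"
abbreviation mns (infixl \<open>-.\<close> 65) where "a -. b \<equiv> sub M a b"
abbreviation tms (infixl \<open>*.\<close> 70) where "a *. b \<equiv> a \<otimes>\<^bsub>M\<^esub> b"
abbreviation lte (infix \<open>\<le>.\<close> 50) where "a \<le>. b \<equiv> leq M a b"

lemma closed [simp, intro]: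
  "zer \<in> carrier M" "uno \<in> carrier M"
  "a \<in> carrier M \<Longrightarrow> b \<in> carrier M \<Longrightarrow> a +. b \<in> carrier M"
  "a \<in> carrier M \<Longrightarrow> b \<in> carrier M \<Longrightarrow> a -. b \<in> carrier M"
  "a \<in> carrier M \<Longrightarrow> b \<in> carrier M \<Longrightarrow> a *. b \<in> carrier M"
  using is_structure by (auto simp: is_structure_def)

lemma range_upd: "range v \<subseteq> carrier M \<Longrightarrow> a \<in> carrier M \<Longrightarrow> range (v(x := a)) \<subseteq> carrier M"
  by auto

lemma tm_val_closed [simp]: "range v \<subseteq> carrier M \<Longrightarrow> tm_val M v t \<in> carrier M"
  by (induction t) auto

lemma tm_val_upd_closed [simp]:
  "range v \<subseteq> carrier M \<Longrightarrow> a \<in> carrier M \<Longrightarrow> tm_val M (v(x := a)) t \<in> carrier M"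
  by (intro tm_val_closed range_upd)

lemma transfer:
  assumes "open_fm p" "\<And>w. sat int_struct w p" "range v \<subseteq> carrier M"
  shows "sat M v p"
  using assms correct[of p] by (auto simp: true_in_def)

lemma transfer3:
  assumes "open_fm p" "\<And>w. sat int_struct w p" "a \<in> carrier M" "b \<in> carrier M" "c \<in> carrier M"
  shows "sat M ((\<lambda>_. zer)(0 := a, 1 := b, 2 := c)) p"
  using assms by (intro transfer) auto

text \<open>Let \<open>q\<close> be the conjunction of the members of \<open>F\<close>, negated
  where they fail in \<open>M\<close>. If no integers satisfied \<open>q\<close>, then
  \<open>Neg q\<close> would be valid in the integers and hence in \<open>M\<close>.\<close>

lemma finite_transfer:
  assumes "finite F" "\<And>p. p \<in> F \<Longrightarrow> open_fm p" "range v \<subseteq> carrier M"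
  obtains w where "\<And>p. p \<in> F \<Longrightarrow> sat int_struct w p \<longleftrightarrow> sat M v p"
proof -
  have "\<exists>q. open_fm q \<and> sat M v q \<and>
      (\<forall>w. sat int_struct w q \<longrightarrow> (\<forall>p\<in>F. sat int_struct w p \<longleftrightarrow> sat M v p))"
    using assms(1,2)
  proof (induction F)
    case empty
    show ?case by (intro exI[of _ "Eq Zero Zero"]) auto
  next
    case (insert p F)
    then obtain q where q: "open_fm q" "sat M v q"
      "\<forall>w. sat int_struct w q \<longrightarrow> (\<forall>p\<in>F. sat int_struct w p \<longleftrightarrow> sat M v p)"
      by auto
    with insert.prems show ?case
      by (intro exI[of _ "Conj q (if sat M v p then p else Neg p)"]) auto
  qed
  then obtain q where q: "open_fm q" "sat M v q"
    "\<And>w p. sat int_struct w q \<Longrightarrow> p \<in> F \<Longrightarrow> sat int_struct w p \<longleftrightarrow> sat M v p"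
    by blast
  have "\<exists>w. sat int_struct w q"
    using transfer[of "Neg q" v] q assms(3) by auto
  then show thesis using q(3) that by blast
qed

lemma add_facts:
  assumes "a \<in> carrier M" "b \<in> carrier M" "c \<in> carrier M"
  shows "a +. b +. c = a +. (b +. c)" "a +. b = b +. a" "zer +. a = a"
    "a +. (zer -. a) = zer" "a -. b +. b = a"
  using transfer3[of "Eq (Add (Add (Var 0) (Var 1)) (Var 2)) (Add (Var 0) (Add (Var 1) (Var 2)))" a b c]
    transfer3[of "Eq (Add (Var 0) (Var 1)) (Add (Var 1) (Var 0))" a b c]
    transfer3[of "Eq (Add Zero (Var 0)) (Var 0)" a b c]
    transfer3[of "Eq (Add (Var 0) (Sub Zero (Var 0))) Zero" a b c]
    transfer3[of "Eq (Add (Sub (Var 0) (Var 1)) (Var 1)) (Var 0)" a b c]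
    assms by (simp_all add: algebra_simps)

lemma mult_facts:
  assumes "a \<in> carrier M" "b \<in> carrier M" "c \<in> carrier M"
  shows "a *. b *. c = a *. (b *. c)" "a *. b = b *. a" "uno *. a = a"
    "(a +. b) *. c = a *. c +. b *. c"
  using transfer3[of "Eq (Mul (Mul (Var 0) (Var 1)) (Var 2)) (Mul (Var 0) (Mul (Var 1) (Var 2)))" a b c]
    transfer3[of "Eq (Mul (Var 0) (Var 1)) (Mul (Var 1) (Var 0))" a b c]
    transfer3[of "Eq (Mul One (Var 0)) (Var 0)" a b c]
    transfer3[of "Eq (Mul (Add (Var 0) (Var 1)) (Var 2)) (Add (Mul (Var 0) (Var 2)) (Mul (Var 1) (Var 2)))" a b c]
    assms by (simp_all add: algebra_simps)

lemma le_refl [simp]: "a \<in> carrier M \<Longrightarrow> a \<le>. a"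
  using transfer3[of "Le (Var 0) (Var 0)" a a a] by simp

lemma le_total:
  assumes "a \<in> carrier M" "b \<in> carrier M"
  shows "a \<le>. b \<or> b \<le>. a"
  using transfer3[of "Disj (Le (Var 0) (Var 1)) (Le (Var 1) (Var 0))" a b b] assms
  by (auto simp: linear)

lemma le_antisym:
  assumes "a \<le>. b" "b \<le>. a" "a \<in> carrier M" "b \<in> carrier M"
  shows "a = b"
  using transfer3[of "Imp (Le (Var 0) (Var 1)) (Imp (Le (Var 1) (Var 0)) (Eq (Var 0) (Var 1)))" a b b]
    assms by simp

lemma le_trans:
  assumes "a \<le>. b" "b \<le>. c" "a \<in> carrier M" "b \<in> carrier M" "c \<in> carrier M"
  shows "a \<le>. c"
  using transfer3[of "Imp (Le (Var 0) (Var 1)) (Imp (Le (Var 1) (Var 2)) (Le (Var 0) (Var 2)))" a b c]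
    assms by simp

lemma int_succ_le_or_le: "a + 1 \<le> b \<or> b \<le> (a :: int)"
  by linarith

text \<open>The language has no strict order, so \<open>a < b\<close> is expressed as
  \<open>\<not> b \<le>. a\<close>. Discreteness turns successor bounds into this form.\<close>

lemma succ_facts [simp]:
  assumes "a \<in> carrier M" "b \<in> carrier M"
  shows "a +. uno \<le>. b \<longleftrightarrow> \<not> b \<le>. a" "a \<le>. a +. uno" "\<not> a +. uno \<le>. a"
  using transfer3[of "Imp (Le (Add (Var 0) One) (Var 1)) (Neg (Le (Var 1) (Var 0)))" a b b]
    transfer3[of "Disj (Le (Add (Var 0) One) (Var 1)) (Le (Var 1) (Var 0))" a b b]
    transfer3[of "Le (Var 0) (Add (Var 0) One)" a b b]
    transfer3[of "Neg (Le (Add (Var 0) One) (Var 0))" a b b]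
    assms int_succ_le_or_le by auto

text \<open>The subtraction symbol makes every axiom universal: the term \<open>zer -. a\<close>
  names the additive inverse.\<close>

lemma discretely_ordered: "discretely_ordered_ring M"
proof -
  have cring: "cring M"
  proof (rule cringI)
    show "abelian_group M"
    proof (rule abelian_groupI)
      fix a assume "a \<in> carrier M"
      then show "\<exists>b\<in>carrier M. b +. a = zer"
        by (intro bexI[of _ "zer -. a"]) (auto simp: add_facts(5)[of _ _ a])
    qed (blast intro: add_facts closed)+
    show "comm_monoid M"
      by (rule comm_monoidI) (blast intro: mult_facts closed)+
  qed (blast intro: mult_facts)
  interpret cring M by (fact cring)
  have zero_one: "zer \<noteq> uno"
    using transfer3[of "Neg (Eq Zero One)" zer zer zer] by auto
  have sub: "a -. b = a \<ominus>\<^bsub>M\<^esub> b" if "a \<in> carrier M" "b \<in> carrier M" for a b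
    using that add_facts(5)[of a b] by (metis minus_eq a_assoc r_neg r_zero a_inv_closed closed(4))
  have lin: "linear_order_on (carrier M) {(a, b). a \<in> carrier M \<and> b \<in> carrier M \<and> a \<le>. b}"
    unfolding linear_order_on_def partial_order_on_def preorder_on_def refl_on_def trans_def
      antisym_def total_on_def
    using le_total le_antisym le_trans by auto
  have add_mono: "a +. c \<le>. b +. c"
    if "a \<in> carrier M" "b \<in> carrier M" "c \<in> carrier M" "a \<le>. b" for a b c
    using transfer3[of "Imp (Le (Var 0) (Var 1)) (Le (Add (Var 0) (Var 2)) (Add (Var 1) (Var 2)))" a b c]
      that by simp
  have mult_nonneg: "zer \<le>. a *. b"
    if "a \<in> carrier M" "b \<in> carrier M" "zer \<le>. a" "zer \<le>. b" for a b
    using transfer3[of "Imp (Le Zero (Var 0)) (Imp (Le Zero (Var 1)) (Le Zero (Mul (Var 0) (Var 1))))" a b b]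
      that by simp
  have discrete: "a = zer \<or> a = uno" if "a \<in> carrier M" "zer \<le>. a" "a \<le>. uno" for a
    using transfer3[of "Imp (Le Zero (Var 0)) (Imp (Le (Var 0) One) (Disj (Eq (Var 0) Zero) (Eq (Var 0) One)))" a a a]
      that by force
  have "ordered_ring M"
    unfolding ordered_ring_def
    by (intro conjI ballI impI cring zero_one sub lin add_mono mult_nonneg) auto
  then show ?thesis
    unfolding discretely_ordered_ring_def using discrete by blast
qed

end

section \<open>From \<open>T\<close> to open induction\<close>

lemma is_model_T_imp_DOI:
  assumes "is_structure M" "is_model M T"
  shows "model_DOI M"
proof -
  have AE: "true_in M (Exists y p)" if "open_fm p" "true_in int_struct (Exists y p)" for y p
    using assms(2) that is_model_T_iff by blast
  interpret universally_correct M
  proof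
    fix p assume p: "open_fm p" "true_in int_struct p"
    obtain y where y: "y \<notin> free_vars p"
      using ex_new_if_finite[OF infinite_UNIV_nat finite_free_vars] by blast
    have "true_in int_struct (Exists y p)"
      using p by (simp add: true_in_def)
    from AE[OF p(1) this] y show "true_in M p"
      unfolding true_in_def using sat_cong[OF p(1)]
      by (metis fun_upd_other sat.simps(7))
  qed (fact assms)
  have "open_induction M"
    unfolding open_induction_def
  proof (intro allI impI ballI; elim conjE; rule ccontr)
    fix p v x b
    assume p: "open_fm p" and v: "range v \<subseteq> carrier M" and p0: "sat M (v(x := zer)) p"
      and step: "\<forall>a\<in>carrier M. zer \<le>. a \<and> sat M (v(x := a)) p \<longrightarrow> sat M (v(x := a +. uno)) p"
      and b: "b \<in> carrier M" "zer \<le>. b" "\<not> sat M (v(x := b)) p"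
    obtain y where y: "y \<notin> insert x (free_vars p)"
      using ex_new_if_finite[OF infinite_UNIV_nat, of "insert x (free_vars p)"] by auto
    have drop: "sat N (u(y := c, x := d)) p \<longleftrightarrow> sat N (u(x := d)) p"
      for N :: "'b oring_struct" and u c d
      using y by (intro sat_cong p) auto
    have drop': "sat N (u(y := c)) p \<longleftrightarrow> sat N u p" for N :: "'b oring_struct" and u c
      using y by (intro sat_cong p) auto
    \<comment> \<open>The variable \<open>x\<close> holds a point where \<open>p\<close> fails, and
      \<open>y\<close> is asked for a point where the induction step breaks.\<close>
    define q where "q =
      Imp (Conj (fsubst x Zero p) (Conj (Le Zero (Var x)) (Neg p)))
        (Conj (Le Zero (Var y))
           (Conj (fsubst x (Var y) p) (Neg (fsubst x (Add (Var y) One) p))))"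
    \<comment> \<open>Without such a \<open>c\<close>, ordinary induction would carry
      \<open>p\<close> from 0 up to \<open>u x\<close>.\<close>
    have change: "\<exists>c\<ge>0. sat int_struct (u(x := c)) p \<and> \<not> sat int_struct (u(x := c + 1)) p"
      if "sat int_struct (u(x := 0)) p" "0 \<le> u x" "\<not> sat int_struct u p" for u
    proof (rule ccontr)
      assume no: "\<not> ?thesis"
      have "sat int_struct (u(x := u x)) p"
        using that(2)
      proof (induction rule: int_ge_induct)
        case base
        show ?case by (fact that(1))
      next
        case (step i)
        then show ?case using no by blast
      qed
      with that show False by simp
    qed
    then have "true_in int_struct (Exists y q)"
      using y p by (auto simp: q_def true_in_def drop drop' fun_upd_twist intro: change)
    then have "true_in M (Exists y q)"
      by (rule AE[rotated]) (simp add: q_def p)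
    moreover have "range (v(x := b)) \<subseteq> carrier M" using v b by auto
    ultimately obtain c where "c \<in> carrier M" "sat M (v(x := b, y := c)) q"
      unfolding true_in_def sat.simps by blast
    \<comment> \<open>The premises of \<open>q\<close> hold at \<open>x = b\<close>, so
      \<open>c\<close> contradicts the induction step.\<close>
    then show False
      using y p p0 b step by (auto simp: q_def drop drop' fun_upd_twist)
  qed
  then show ?thesis
    using discretely_ordered correct
    by (auto simp: model_DOI_def model_OI_def diophantine_correct_iff discretely_ordered_ring_def)
qed

section \<open>Forward differences\<close>

definition \<Delta> :: "(int \<Rightarrow> int) \<Rightarrow> int \<Rightarrow> int" where
  "\<Delta> g = (\<lambda>y. g (y + 1) - g y)"

lemma \<Delta>_zero [simp]: "\<Delta> (\<lambda>_. 0) = (\<lambda>_. 0)"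
  by (simp add: \<Delta>_def)

lemma \<Delta>_pow_zero: "(\<Delta> ^^ n) (\<lambda>_. 0) = (\<lambda>_. 0)"
  by (induction n) auto

lemma \<Delta>_pow_Suc: "(\<Delta> ^^ Suc n) g = (\<Delta> ^^ n) (\<Delta> g)"
  by (simp only: funpow_Suc_right o_apply)

lemma \<Delta>_pow_mono:
  assumes "(\<Delta> ^^ m) g = (\<lambda>_. 0)" "m \<le> n"
  shows "(\<Delta> ^^ n) g = (\<lambda>_. 0)"
proof -
  have "(\<Delta> ^^ (n - m + m)) g = (\<lambda>_. 0)"
    unfolding funpow_add o_apply assms(1) by (rule \<Delta>_pow_zero)
  then show ?thesis using assms(2) by simp
qed

lemma \<Delta>_pow_add:
  "(\<Delta> ^^ n) (\<lambda>y. g y + h y) = (\<lambda>y. (\<Delta> ^^ n) g y + (\<Delta> ^^ n) h y)"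
  by (induction n) (auto simp: \<Delta>_def)

lemma \<Delta>_pow_diff:
  "(\<Delta> ^^ n) (\<lambda>y. g y - h y) = (\<lambda>y. (\<Delta> ^^ n) g y - (\<Delta> ^^ n) h y)"
  by (induction n) (auto simp: \<Delta>_def)

lemma \<Delta>_mult: "\<Delta> (\<lambda>y. g y * h y) = (\<lambda>y. \<Delta> g y * (h y + \<Delta> h y) + g y * \<Delta> h y)"
  by (auto simp: \<Delta>_def algebra_simps)

text \<open>Each summand of the product rule \<open>\<Delta>_mult\<close> lowers the order of one
  factor by one, so induction on the sum of the orders applies to both.\<close>

lemma \<Delta>_pow_mult:
  "(\<Delta> ^^ m) g = (\<lambda>_. 0) \<Longrightarrow> (\<Delta> ^^ n) h = (\<lambda>_. 0) \<Longrightarrow> (\<Delta> ^^ (m + n)) (\<lambda>y. g y * h y) = (\<lambda>_. 0)"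
proof (induction "m + n" arbitrary: m n g h)
  case 0
  then show ?case by simp
next
  case (Suc k)
  show ?case
  proof (cases "m = 0 \<or> n = 0")
    case True
    then have "(\<lambda>y. g y * h y) = (\<lambda>_. 0)" using Suc.prems by (auto dest: fun_cong)
    then show ?thesis by (simp only: \<Delta>_pow_zero)
  next
    case False
    then obtain m' n' where mn: "m = Suc m'" "n = Suc n'"
      by (metis not0_implies_Suc)
    have g: "(\<Delta> ^^ m') (\<Delta> g) = (\<lambda>_. 0)" and h: "(\<Delta> ^^ n') (\<Delta> h) = (\<lambda>_. 0)"
      using Suc.prems unfolding mn \<Delta>_pow_Suc by auto
    have "(\<Delta> ^^ n) (\<Delta> h) = (\<lambda>_. 0)"
      using h by (rule \<Delta>_pow_mono) (simp add: mn)
    then have "(\<Delta> ^^ n) (\<lambda>y. h y + \<Delta> h y) = (\<lambda>_. 0)"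
      using Suc.prems(2) by (simp add: \<Delta>_pow_add)
    then have "(\<Delta> ^^ (m' + n)) (\<lambda>y. \<Delta> g y * (h y + \<Delta> h y)) = (\<lambda>_. 0)"
      by (intro Suc.hyps(1) g) (use Suc.hyps(2) mn in auto)
    moreover have "(\<Delta> ^^ (m + n')) (\<lambda>y. g y * \<Delta> h y) = (\<lambda>_. 0)"
      by (intro Suc.hyps(1) h Suc.prems(1)) (use Suc.hyps(2) mn in auto)
    moreover have "m + n = Suc (m' + n)" "m + n' = m' + n" using mn by auto
    ultimately show ?thesis
      by (simp only: \<Delta>_pow_Suc \<Delta>_mult \<Delta>_pow_add) simp
  qed
qed

text \<open>By induction the weak sign of \<open>\<Delta> g\<close> is constant between
  \<open>a\<close> and \<open>b\<close>, so \<open>g\<close> is monotone there. Equal weak signs at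
  both ends then fix the sign in between.\<close>

lemma \<Delta>_sign_interval:
  assumes "(\<Delta> ^^ n) g = (\<lambda>_. 0)"
    and "\<And>j. j \<le> n \<Longrightarrow> 0 \<le> (\<Delta> ^^ j) g a \<longleftrightarrow> 0 \<le> (\<Delta> ^^ j) g b"
    and "a \<le> y" "y \<le> b"
  shows "0 \<le> g y \<longleftrightarrow> 0 \<le> g a"
  using assms
proof (induction n arbitrary: g y)
  case 0
  then show ?case by simp
next
  case (Suc n)
  have sign: "0 \<le> \<Delta> g z \<longleftrightarrow> 0 \<le> \<Delta> g a" if "a \<le> z" "z \<le> b" for z
    using Suc.prems(1) Suc.prems(2)[of "Suc _"] that unfolding \<Delta>_pow_Suc
    by (intro Suc.IH) auto
  have ends: "0 \<le> g a \<longleftrightarrow> 0 \<le> g b" using Suc.prems(2)[of 0] by simp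
  show ?case
  proof (cases "0 \<le> \<Delta> g a")
    case True
    have mono: "g u \<le> g z" if "u \<le> z" "a \<le> u" "z \<le> b" for u z
      using that
    proof (induction rule: int_ge_induct)
      case (step i)
      then show ?case using sign[of i] True by (auto simp: \<Delta>_def)
    qed simp
    show ?thesis
      using mono[of a y] mono[of y b] ends Suc.prems(3,4) by linarith
  next
    case False
    have mono: "g z \<le> g u" if "u \<le> z" "a \<le> u" "z \<le> b" for u z
      using that
    proof (induction rule: int_ge_induct)
      case (step i)
      then show ?case using sign[of i] False by (auto simp: \<Delta>_def)
    qed simp
    show ?thesis
      using mono[of a y] mono[of y b] ends Suc.prems(3,4) by linarith
  qed
qed

text \<open>By induction \<open>\<Delta> g\<close> keeps its exact sign beyond \<open>a\<close>. If
  it is zero, \<open>g\<close> is constant; otherwise \<open>g\<close> starts with the same sign as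
  \<open>\<Delta> g\<close> and moves away from zero.\<close>

lemma \<Delta>_sign_tail:
  assumes "(\<Delta> ^^ n) g = (\<lambda>_. 0)"
    and "\<And>j. j < n \<Longrightarrow> 0 < (\<Delta> ^^ Suc j) g a \<Longrightarrow> 0 < (\<Delta> ^^ j) g a"
    and "\<And>j. j < n \<Longrightarrow> (\<Delta> ^^ Suc j) g a < 0 \<Longrightarrow> (\<Delta> ^^ j) g a < 0"
    and "a \<le> y"
  shows "sgn (g y) = sgn (g a)"
  using assms
proof (induction n arbitrary: g y)
  case 0
  then show ?case by simp
next
  case (Suc n)
  have sign: "sgn (\<Delta> g z) = sgn (\<Delta> g a)" if "a \<le> z" for z
  proof (rule Suc.IH[OF _ _ _ that])
    show "(\<Delta> ^^ n) (\<Delta> g) = (\<lambda>_. 0)"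
      using Suc.prems(1) by (simp only: \<Delta>_pow_Suc)
    fix j assume "j < n"
    then show "0 < (\<Delta> ^^ Suc j) (\<Delta> g) a \<Longrightarrow> 0 < (\<Delta> ^^ j) (\<Delta> g) a"
      and "(\<Delta> ^^ Suc j) (\<Delta> g) a < 0 \<Longrightarrow> (\<Delta> ^^ j) (\<Delta> g) a < 0"
      using Suc.prems(2,3)[of "Suc j"] by (simp_all only: \<Delta>_pow_Suc Suc_less_eq)
  qed
  have pos: "0 < \<Delta> g a \<Longrightarrow> 0 < g a" and neg: "\<Delta> g a < 0 \<Longrightarrow> g a < 0"
    using Suc.prems(2,3)[of 0] by auto
  show ?case using Suc.prems(4)
  proof (induction rule: int_ge_induct)
    case (step i)
    then show ?case
      using sign[of i] pos neg by (auto simp: \<Delta>_def sgn_if split: if_splits)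
  qed simp
qed

text \<open>An upper bound for the degree plus one, that is, a number of differences that
  annihilates the term. All variables are treated alike, and products follow
  \<open>\<Delta>_pow_mult\<close>.\<close>

primrec tdeg :: "tm \<Rightarrow> nat" where
  "tdeg (Var i) = 2"
| "tdeg Zero = 1"
| "tdeg One = 1"
| "tdeg (Add s t) = max (tdeg s) (tdeg t)"
| "tdeg (Sub s t) = max (tdeg s) (tdeg t)"
| "tdeg (Mul s t) = tdeg s + tdeg t"

lemma \<Delta>_pow_tdeg: "(\<Delta> ^^ tdeg t) (\<lambda>y. tm_val int_struct (w(x := y)) t) = (\<lambda>_. 0)"
proof (induction t)
  case (Add s t)
  then show ?case
    using \<Delta>_pow_mono[OF Add.IH(1), of "tdeg (Add s t)"] \<Delta>_pow_mono[OF Add.IH(2), of "tdeg (Add s t)"]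
    by (simp add: \<Delta>_pow_add)
next
  case (Sub s t)
  then show ?case
    using \<Delta>_pow_mono[OF Sub.IH(1), of "tdeg (Sub s t)"] \<Delta>_pow_mono[OF Sub.IH(2), of "tdeg (Sub s t)"]
    by (simp add: \<Delta>_pow_diff)
next
  case (Mul s t)
  then show ?case by (simp add: \<Delta>_pow_mult)
qed (auto simp: \<Delta>_def numeral_2_eq_2)

text \<open>The forward difference as a term, so that it has a value in every structure and its sign
  is an open formula.\<close>

definition fdiff :: "nat \<Rightarrow> tm \<Rightarrow> tm" where
  "fdiff x t = Sub (tsubst x (Add (Var x) One) t) t"

lemma tm_val_fdiff [simp]:
  "tm_val M v (fdiff x t) =
     sub M (tm_val M (v(x := v x \<oplus>\<^bsub>M\<^esub> \<one>\<^bsub>M\<^esub>)) t) (tm_val M v t)"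
  by (simp add: fdiff_def)

lemma tm_val_fdiff_pow:
  "tm_val int_struct (w(x := y)) ((fdiff x ^^ n) t) =
     (\<Delta> ^^ n) (\<lambda>y. tm_val int_struct (w(x := y)) t) y"
  by (induction n arbitrary: y) (auto simp: \<Delta>_def)

lemma fdiff_pow_tdeg: "tm_val int_struct w ((fdiff x ^^ tdeg t) t) = 0"
  using tm_val_fdiff_pow[of w x "w x" "tdeg t" t] \<Delta>_pow_tdeg[of t w x] by simp


section \<open>Sign changes in models of open induction\<close>

text \<open>Only the weak sign is compared, so zero counts as non-negative. A passage from positive
  to zero shows up as a change of \<open>Sub Zero t\<close>.\<close>

definition changes :: "'a oring_struct \<Rightarrow> (nat \<Rightarrow> 'a) \<Rightarrow> nat \<Rightarrow> tm \<Rightarrow> 'a set" where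
  "changes M v x t = {y \<in> carrier M. leq M \<zero>\<^bsub>M\<^esub> y \<and>
     (sat M (v(x := y)) (Le Zero t) \<longleftrightarrow> \<not> sat M (v(x := y \<oplus>\<^bsub>M\<^esub> \<one>\<^bsub>M\<^esub>)) (Le Zero t))}"

locale dioph_open_induction = universally_correct +
  assumes open_induction: "open_induction M"
begin

text \<open>Open induction starts at zero, so \<open>q\<close> is guarded by bounds on
  \<open>x\<close>, with \<open>a\<close> and \<open>b\<close> as parameters in fresh variables.
  Outside the interval the guarded formula holds vacuously.\<close>

lemma interval_induct:
  assumes q: "open_fm q" and v: "range v \<subseteq> carrier M"
    and ab: "a \<in> carrier M" "b \<in> carrier M" "zer \<le>. a" "a \<le>. b"
    and base: "sat M (v(x := a)) q"
    and step: "\<And>z. \<lbrakk>z \<in> carrier M; a \<le>. z; \<not> b \<le>. z; sat M (v(x := z)) q\<rbrakk>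
                 \<Longrightarrow> sat M (v(x := z +. uno)) q"
  shows "sat M (v(x := b)) q"
proof -
  obtain i where i: "i \<notin> insert x (free_vars q)"
    using ex_new_if_finite[OF infinite_UNIV_nat, of "insert x (free_vars q)"] by auto
  obtain j where j: "j \<notin> insert i (insert x (free_vars q))"
    using ex_new_if_finite[OF infinite_UNIV_nat, of "insert i (insert x (free_vars q))"] by auto
  define p where "p = Imp (Conj (Le (Var i) (Var x)) (Le (Var x) (Var j))) q"
  define v' where "v' = v(i := a, j := b)"
  have v': "range v' \<subseteq> carrier M" unfolding v'_def using v ab by auto
  have drop: "sat M (v'(x := z)) q \<longleftrightarrow> sat M (v(x := z)) q" for z
    using i j by (intro sat_cong q) (auto simp: v'_def)
  have sat_p: "sat M (v'(x := z)) p \<longleftrightarrow> (a \<le>. z \<and> z \<le>. b \<longrightarrow> sat M (v(x := z)) q)" for z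
    using i j by (auto simp: p_def drop) (auto simp: v'_def)
  have "open_fm p" using q by (simp add: p_def)
  moreover have "sat M (v'(x := zer)) p"
    using sat_p base ab le_antisym by (metis closed(1))
  moreover have "sat M (v'(x := z +. uno)) p"
    if z: "z \<in> carrier M" "zer \<le>. z" and pz: "sat M (v'(x := z)) p" for z
    unfolding sat_p
  proof (intro impI, elim conjE)
    assume az: "a \<le>. z +. uno" and zb: "z +. uno \<le>. b"
    then have zb': "\<not> b \<le>. z" "z \<le>. b" using z ab le_total by auto
    show "sat M (v(x := z +. uno)) q"
    proof (cases "a \<le>. z")
      case True
      then show ?thesis using pz zb' step z by (auto simp: sat_p)
    next
      case False
      \<comment> \<open>Here \<open>z\<close> lies below the interval and its successor does not, so
        discreteness forces the successor to be \<open>a\<close>.\<close>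
      then have "a = z +. uno"
        using az z ab by (intro le_antisym) auto
      then show ?thesis using base by simp
    qed
  qed
  ultimately have "sat M (v'(x := b)) p"
    using open_induction[unfolded open_induction_def, rule_format, of p v' x b]
      v' ab le_trans[of zer a b] by simp
  then show ?thesis using ab by (simp add: sat_p)
qed

text \<open>Interval induction is applied to whichever sign holds at \<open>a\<close>. A change at
  \<open>b\<close> itself is allowed, since it concerns only the passage to
  \<open>b +. uno\<close>.\<close>

lemma sign_constant:
  assumes v: "range v \<subseteq> carrier M"
    and ab: "a \<in> carrier M" "b \<in> carrier M" "zer \<le>. a" "a \<le>. b"
    and no: "\<And>z. z \<in> changes M v x t \<Longrightarrow> a \<le>. z \<Longrightarrow> b \<le>. z"
  shows "sat M (v(x := b)) (Le Zero t) \<longleftrightarrow> sat M (v(x := a)) (Le Zero t)"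
proof -
  define q where "q = (if sat M (v(x := a)) (Le Zero t) then Le Zero t else Neg (Le Zero t))"
  have "sat M (v(x := b)) q"
  proof (rule interval_induct)
    fix z assume z: "z \<in> carrier M" "a \<le>. z" "\<not> b \<le>. z" and q: "sat M (v(x := z)) q"
    then have "zer \<le>. z" using ab le_trans closed(1) by blast
    moreover have "z \<notin> changes M v x t" using no z by blast
    ultimately show "sat M (v(x := z +. uno)) q"
      using z q by (auto simp: changes_def q_def)
  qed (use v ab in \<open>auto simp: q_def\<close>)
  then show ?thesis by (auto simp: q_def split: if_splits)
qed

text \<open>Between sign changes of its difference a term is monotone, so it changes sign at most once.\<close>

lemma changes_gap:
  assumes v: "range v \<subseteq> carrier M"
    and c: "c \<in> changes M v x t" and d: "d \<in> changes M v x t" and cd: "\<not> d \<le>. c"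
  shows "\<exists>z\<in>changes M v x (fdiff x t). c \<le>. z \<and> \<not> d \<le>. z"
proof (rule ccontr)
  assume no: "\<not> ?thesis"
  have C: "c \<in> carrier M" "zer \<le>. c" and D: "d \<in> carrier M" "zer \<le>. d"
    using c d by (auto simp: changes_def)
  have "c \<le>. d" using cd C D le_total by blast
  have const: "sat M (v(x := z)) (Le Zero (fdiff x t)) \<longleftrightarrow> sat M (v(x := c)) (Le Zero (fdiff x t))"
    if "z \<in> carrier M" "c \<le>. z" "z \<le>. d" for z
  proof (rule sign_constant[OF v])
    fix u assume u: "u \<in> changes M v x (fdiff x t)" "c \<le>. u"
    then have "u \<in> carrier M" by (simp add: changes_def)
    moreover have "d \<le>. u" using no u by blast
    ultimately show "z \<le>. u" using that D le_trans by blast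
  qed (use that C in auto)
  have up: "sat M (v(x := z +. uno)) (Le Zero t)"
    if "sat M (v(x := z)) (Le Zero (fdiff x t))" "sat M (v(x := z)) (Le Zero t)" "z \<in> carrier M" for z
  proof -
    have "sat M (v(x := z)) (Imp (Le Zero (fdiff x t))
        (Imp (Le Zero t) (Le Zero (tsubst x (Add (Var x) One) t))))"
      by (rule transfer) (use v that(3) in auto)
    then show ?thesis using that(1,2) by simp
  qed
  have down: "\<not> sat M (v(x := z +. uno)) (Le Zero t)"
    if "\<not> sat M (v(x := z)) (Le Zero (fdiff x t))" "\<not> sat M (v(x := z)) (Le Zero t)" "z \<in> carrier M" for z
  proof -
    have "sat M (v(x := z)) (Imp (Neg (Le Zero (fdiff x t)))
        (Imp (Neg (Le Zero t)) (Neg (Le Zero (tsubst x (Add (Var x) One) t)))))"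
      by (rule transfer) (use v that(3) in auto)
    then show ?thesis using that(1,2) by simp
  qed
  \<comment> \<open>The sign of \<open>t\<close> that is preserved by the constant sign of its
    difference.\<close>
  define q where
    "q = (if sat M (v(x := c)) (Le Zero (fdiff x t)) then Le Zero t else Neg (Le Zero t))"
  have step: "sat M (v(x := z +. uno)) q"
    if "z \<in> carrier M" "c \<le>. z" "z \<le>. d" "sat M (v(x := z)) q" for z
    using const[OF that(1-3)] up[OF _ _ that(1)] down[OF _ _ that(1)] that(4)
    by (auto simp: q_def split: if_splits)
  have flip: "sat M (v(x := z +. uno)) q \<longleftrightarrow> \<not> sat M (v(x := z)) q" if "z \<in> changes M v x t" for z
    using that by (auto simp: changes_def q_def)
  \<comment> \<open>If \<open>q\<close> held at \<open>c\<close> it would persist, although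
    \<open>c\<close> is a change; so it holds at \<open>c +. uno\<close>. From there it persists
    past \<open>d\<close>, although \<open>d\<close> is a change.\<close>
  have "sat M (v(x := c +. uno)) q"
    using flip[OF c] step[of c] C \<open>c \<le>. d\<close> by auto
  then have "sat M (v(x := d)) q"
  proof (rule interval_induct[rotated 6])
    show "zer \<le>. c +. uno" using C le_trans[of zer c "c +. uno"] by simp
    fix z assume z: "z \<in> carrier M" "c +. uno \<le>. z" "\<not> d \<le>. z" "sat M (v(x := z)) q"
    then have "c \<le>. z" "z \<le>. d" using C D le_total by auto
    with z step show "sat M (v(x := z +. uno)) q" by blast
  qed (use v C D cd in \<open>auto simp: q_def\<close>)
  then show False
    using flip[OF d] step[of d] C D \<open>c \<le>. d\<close> by auto
qed

text \<open>Iterated differences end in a term that vanishes on the integers and so never changes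
  sign in \<open>M\<close>. Going back up, a change of \<open>t\<close> is determined by the changes
  of its difference below it.\<close>

lemma finite_changes:
  assumes v: "range v \<subseteq> carrier M"
  shows "finite (changes M v x t)"
proof -
  have "finite (changes M v x t)" if "\<And>w. tm_val int_struct w ((fdiff x ^^ n) t) = 0" for n t
    using that
  proof (induction n arbitrary: t)
    case 0
    have "sat M (v(x := y)) (Le Zero t)" if "y \<in> carrier M" for y
      by (rule transfer[OF _ _ range_upd[OF v that]]) (use 0 in auto)
    then have "changes M v x t = {}"
      by (auto simp: changes_def)
    then show ?case by simp
  next
    case (Suc n)
    then have fin: "finite (changes M v x (fdiff x t))"
      by (intro Suc.IH) (simp add: funpow_swap1)
    \<comment> \<open>For \<open>c\<close> before \<open>d\<close>, \<open>changes_gap\<close> puts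
      a change of the difference into \<open>below d\<close> but not into
      \<open>below c\<close>.\<close>
    define below where "below c = {z \<in> changes M v x (fdiff x t). \<not> c \<le>. z}" for c
    have "inj_on below (changes M v x t)"
    proof (rule inj_onI, rule ccontr)
      fix c d
      assume c: "c \<in> changes M v x t" and d: "d \<in> changes M v x t"
        and eq: "below c = below d" and "c \<noteq> d"
      have "c \<in> carrier M" "d \<in> carrier M" using c d by (auto simp: changes_def)
      with \<open>c \<noteq> d\<close> consider "\<not> d \<le>. c" | "\<not> c \<le>. d" using le_antisym by blast
      then show False
        using changes_gap[OF v c d] changes_gap[OF v d c] eq by cases (auto simp: below_def)
    qed
    moreover have "below ` changes M v x t \<subseteq> Pow (changes M v x (fdiff x t))"
      by (auto simp: below_def)
    ultimately show ?case
      using fin by (meson finite_Pow_iff finite_imageD finite_subset)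
  qed
  then show ?thesis using fdiff_pow_tdeg by blast
qed

text \<open>By discreteness a positive difference is at least one, so \<open>t\<close> stays above a
  line of slope one, which becomes positive. Positivity is written as the failure of
  \<open>Le Zero (Sub Zero t)\<close>.\<close>

lemma unbounded_growth:
  assumes v: "range v \<subseteq> carrier M" and a: "a \<in> carrier M" "zer \<le>. a"
    and pos: "\<And>z. z \<in> carrier M \<Longrightarrow> a \<le>. z \<Longrightarrow> \<not> sat M (v(x := z)) (Le Zero (Sub Zero (fdiff x t)))"
  shows "\<exists>b\<in>carrier M. a \<le>. b \<and> \<not> sat M (v(x := b)) (Le Zero (Sub Zero t))"
proof (cases "sat M (v(x := a)) (Le Zero (Sub Zero t))")
  case False
  then show ?thesis using a by (intro bexI[of _ a]) auto
next
  case True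
  obtain i where i: "i \<notin> insert x (tm_vars t)"
    using ex_new_if_finite[OF infinite_UNIV_nat, of "insert x (tm_vars t)"] by auto
  obtain j where j: "j \<notin> insert i (insert x (tm_vars t))"
    using ex_new_if_finite[OF infinite_UNIV_nat, of "insert i (insert x (tm_vars t))"] by auto
  define c where "c = tm_val M (v(x := a)) t"
  \<comment> \<open>The line of slope one through the value \<open>c\<close> at \<open>a\<close>
    takes the value one here. Since \<open>c\<close> is at most zero in this case, \<open>b\<close>
    is not below \<open>a\<close>.\<close>
  define b where "b = a +. uno -. c"
  define v' where "v' = v(i := a, j := c)"
  have c: "c \<in> carrier M" unfolding c_def using v a by (simp add: range_upd)
  then have b: "b \<in> carrier M" using a by (simp add: b_def)
  have v': "range v' \<subseteq> carrier M" unfolding v'_def using v a c by auto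
  have drop: "tm_val M (v'(x := z)) t = tm_val M (v(x := z)) t" for z
    using i j by (intro tm_val_cong) (auto simp: v'_def)
  have drop': "tm_val M (v'(x := z)) (fdiff x t) = tm_val M (v(x := z)) (fdiff x t)" for z
    using drop by simp
  have vars: "(v'(x := z)) i = a" "(v'(x := z)) j = c" for z
    using i j by (auto simp: v'_def)
  have ab: "a \<le>. b"
    using transfer3[of "Imp (Le Zero (Sub Zero (Var 0))) (Le (Var 1) (Sub (Add (Var 1) One) (Var 0)))" c a a]
      True a c by (simp add: b_def c_def)
  define q where "q = Le (Add (Var j) (Var x)) (Add t (Var i))"
  have "sat M (v'(x := b)) q"
  proof (rule interval_induct[OF _ v' a(1) b a(2) ab])
    show "sat M (v'(x := a)) q"
      unfolding q_def sat.simps tm_val.simps drop vars using a c by (simp add: c_def)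
    fix z assume z: "z \<in> carrier M" "a \<le>. z" "sat M (v'(x := z)) q"
    have "sat M (v'(x := z)) (Imp (Neg (Le Zero (Sub Zero (fdiff x t)))) (Imp q (fsubst x (Add (Var x) One) q)))"
      by (rule transfer) (use v' z i j in \<open>auto simp: q_def range_upd\<close>)
    moreover have "\<not> sat M (v'(x := z)) (Le Zero (Sub Zero (fdiff x t)))"
      using pos[OF z(1,2)] unfolding sat.simps tm_val.simps drop' .
    moreover have "open_fm q" by (simp add: q_def)
    ultimately show "sat M (v'(x := z +. uno)) q"
      using z(3) by simp
  qed (simp add: q_def)
  then have "c +. b \<le>. tm_val M (v(x := b)) t +. a"
    unfolding q_def sat.simps tm_val.simps drop vars by simp
  then have "\<not> zer \<le>. zer -. tm_val M (v(x := b)) t"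
    using transfer3[of "Imp (Le (Add (Var 0) (Sub (Add (Var 1) One) (Var 0))) (Add (Var 2) (Var 1)))
        (Neg (Le Zero (Sub Zero (Var 2))))" c a "tm_val M (v(x := b)) t"] a b c v
    by (simp add: b_def range_upd)
  then show ?thesis using b ab by auto
qed

text \<open>From \<open>a\<close> on no signs change. A positive difference thus stays positive,
  growth makes \<open>t\<close> positive somewhere, and hence already at \<open>a\<close>. The
  negative case uses \<open>Sub Zero t\<close>.\<close>

lemma tail_sign:
  assumes v: "range v \<subseteq> carrier M" and a: "a \<in> carrier M" "zer \<le>. a"
    and no: "\<And>z s. s \<in> {t, Sub Zero t, fdiff x t, Sub Zero (fdiff x t)} \<Longrightarrow>
               z \<in> changes M v x s \<Longrightarrow> \<not> a \<le>. z"
  shows "\<not> sat M (v(x := a)) (Le Zero (Sub Zero (fdiff x t))) \<Longrightarrow>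
           \<not> sat M (v(x := a)) (Le Zero (Sub Zero t))"
    and "\<not> sat M (v(x := a)) (Le Zero (fdiff x t)) \<Longrightarrow> \<not> sat M (v(x := a)) (Le Zero t)"
proof -
  have const: "sat M (v(x := z)) (Le Zero s) \<longleftrightarrow> sat M (v(x := a)) (Le Zero s)"
    if "s \<in> {t, Sub Zero t, fdiff x t, Sub Zero (fdiff x t)}" "z \<in> carrier M" "a \<le>. z" for s z
    using that no a by (intro sign_constant v) blast+
  show "\<not> sat M (v(x := a)) (Le Zero (Sub Zero t))"
    if "\<not> sat M (v(x := a)) (Le Zero (Sub Zero (fdiff x t)))"
    using unbounded_growth[OF v a, of x t] that const by blast
  \<comment> \<open>Double negations are different terms, so their equality in value is transferred
    from the integers.\<close>
  have neg: "sat M u (Le Zero (Sub Zero (Sub Zero t))) \<longleftrightarrow> sat M u (Le Zero t)"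
    "sat M u (Le Zero (Sub Zero (fdiff x (Sub Zero t)))) \<longleftrightarrow> sat M u (Le Zero (fdiff x t))"
    if "range u \<subseteq> carrier M" for u
  proof -
    have "sat M u (Conj (Eq (Sub Zero (Sub Zero t)) t) (Eq (Sub Zero (fdiff x (Sub Zero t))) (fdiff x t)))"
      by (rule transfer) (use that in auto)
    then show "sat M u (Le Zero (Sub Zero (Sub Zero t))) \<longleftrightarrow> sat M u (Le Zero t)"
      "sat M u (Le Zero (Sub Zero (fdiff x (Sub Zero t)))) \<longleftrightarrow> sat M u (Le Zero (fdiff x t))"
      by (simp_all del: tm_val_fdiff)
  qed
  show "\<not> sat M (v(x := a)) (Le Zero t)" if "\<not> sat M (v(x := a)) (Le Zero (fdiff x t))"
  proof -
    have "\<not> sat M (v(x := z)) (Le Zero (Sub Zero (fdiff x (Sub Zero t))))"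
      if z: "z \<in> carrier M" "a \<le>. z" for z
      unfolding neg(2)[OF range_upd[OF v z(1)]]
      using const[of "fdiff x t" z] z \<open>\<not> sat M (v(x := a)) (Le Zero (fdiff x t))\<close> by blast
    then obtain b where b: "b \<in> carrier M" "a \<le>. b"
      "\<not> sat M (v(x := b)) (Le Zero (Sub Zero (Sub Zero t)))"
      using unbounded_growth[OF v a, of x "Sub Zero t"] by blast
    then show ?thesis
      using const[of t b] unfolding neg(1)[OF range_upd[OF v b(1)]] by blast
  qed
qed

end

section \<open>Transferring one existential quantifier\<close>

text \<open>An equation contributes both differences because it amounts to two weak
  inequalities.\<close>

primrec atoms :: "fm \<Rightarrow> tm set" where
  "atoms (Eq s t) = {Sub s t, Sub t s}"
| "atoms (Le s t) = {Sub t s}"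
| "atoms (Neg p) = atoms p"
| "atoms (Conj p q) = atoms p \<union> atoms q"
| "atoms (Disj p q) = atoms p \<union> atoms q"
| "atoms (Forall i p) = {}"
| "atoms (Exists i p) = {}"

lemma finite_atoms: "finite (atoms p)"
  by (induction p) auto

lemma sat_int_atoms_cong:
  "open_fm p \<Longrightarrow>
   \<forall>t\<in>atoms p. 0 \<le> tm_val int_struct u t \<longleftrightarrow> 0 \<le> tm_val int_struct w t \<Longrightarrow>
   sat int_struct u p \<longleftrightarrow> sat int_struct w p"
  by (induction p) auto

text \<open>The integer solution is moved down to the greatest copied point not exceeding it, where
  every atom of \<open>p\<close> has the same weak sign.\<close>

lemma (in dioph_open_induction) exists_nonneg_transfer:
  assumes p: "open_fm p" and v: "range v \<subseteq> carrier M"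
    and ex: "\<And>w. \<exists>y\<ge>0. sat int_struct (w(x := y)) p"
  shows "\<exists>a\<in>carrier M. sat M (v(x := a)) p"
proof -
  define G where "G = (\<lambda>(t, j). (fdiff x ^^ j) t) ` (SIGMA t:atoms p. {..tdeg t})"
  \<comment> \<open>Including negatives lets weak signs determine strict ones.\<close>
  define S where "S = G \<union> Sub Zero ` G"
  have "finite S" by (simp add: S_def G_def finite_atoms)
  have G: "(fdiff x ^^ j) t \<in> G" if "t \<in> atoms p" "j \<le> tdeg t" for t j
    using that by (force simp: G_def)
  define C where "C = (\<Union>s\<in>S. changes M v x s)"
  have "finite C" using \<open>finite S\<close> finite_changes[OF v] by (simp add: C_def)
  then have "finite (insert zer (C \<union> (\<lambda>c. c +. uno) ` C))" by simp
  \<comment> \<open>Both sides of every change are sampled, and \<open>zer\<close> ensures a sample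
    point below any non-negative integer.\<close>
  then obtain rs where rs: "set rs = insert zer (C \<union> (\<lambda>c. c +. uno) ` C)"
    using finite_list by blast
  define n where "n = length rs"
  have C: "c \<in> carrier M" "zer \<le>. c" if "c \<in> C" for c
    using that by (auto simp: C_def changes_def)
  have nonneg: "rs ! i \<in> carrier M \<and> zer \<le>. rs ! i" if "i < n" for i
  proof -
    have "rs ! i \<in> set rs" using that by (simp add: n_def)
    moreover have "zer \<le>. c +. uno" if "c \<in> C" for c
      using that C[of c] le_trans[of zer c "c +. uno"] by simp
    ultimately show ?thesis unfolding rs using C by auto
  qed
  have "finite (insert x (free_vars p \<union> (\<Union>s\<in>S. tm_vars s)))" using \<open>finite S\<close> by simp
  then obtain m where m: "\<And>i. i \<in> insert x (free_vars p \<union> (\<Union>s\<in>S. tm_vars s)) \<Longrightarrow> i < m"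
    unfolding finite_nat_set_iff_bounded by blast
  \<comment> \<open>The sample points occupy the variables from \<open>m\<close> on, beyond all
    those in use.\<close>
  define v' where "v' i = (if i < m then v i else if i < m + n then rs ! (i - m) else zer)" for i
  have v': "range v' \<subseteq> carrier M"
    using v nonneg by (auto simp: v'_def)
  have v'_at: "v' (m + i) = rs ! i" if "i < n" for i
    using that by (simp add: v'_def)
  have v'_tm: "tm_val M (v'(x := a)) s = tm_val M (v(x := a)) s" if "s \<in> S" for a s
  proof (rule tm_val_cong)
    fix i assume "i \<in> tm_vars s"
    with that have "i < m" by (intro m) blast
    then show "(v'(x := a)) i = (v(x := a)) i" by (simp add: v'_def)
  qed
  have v'_fm: "sat M (v'(x := a)) p \<longleftrightarrow> sat M (v(x := a)) p" for a
  proof (rule sat_cong[OF p])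
    fix i assume "i \<in> free_vars p"
    then have "i < m" by (intro m) blast
    then show "(v'(x := a)) i = (v(x := a)) i" by (simp add: v'_def)
  qed
  define F where "F =
    (\<lambda>(i, j). Le (Var (m + i)) (Var (m + j))) ` ({..<n} \<times> {..<n}) \<union>
    (\<lambda>(i, j). Eq (Var (m + j)) (Add (Var (m + i)) One)) ` ({..<n} \<times> {..<n}) \<union>
    (\<lambda>i. Eq (Var (m + i)) Zero) ` {..<n} \<union>
    (\<lambda>(i, s). Le Zero (tsubst x (Var (m + i)) s)) ` ({..<n} \<times> S) \<union>
    (\<lambda>i. fsubst x (Var (m + i)) p) ` {..<n}"
  have "finite F" using \<open>finite S\<close> by (simp add: F_def)
  moreover have "open_fm q" if "q \<in> F" for q using that p by (auto simp: F_def)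
  ultimately obtain w where w: "\<And>q. q \<in> F \<Longrightarrow> sat int_struct w q \<longleftrightarrow> sat M v' q"
    using finite_transfer v' by blast
  define u where "u i = w (m + i)" for i
  have le: "u i \<le> u j \<longleftrightarrow> rs ! i \<le>. rs ! j" if "i < n" "j < n" for i j
    using w[of "Le (Var (m + i)) (Var (m + j))"] that by (force simp: F_def u_def v'_at)
  have succ: "u j = u i + 1 \<longleftrightarrow> rs ! j = rs ! i +. uno" if "i < n" "j < n" for i j
    using w[of "Eq (Var (m + j)) (Add (Var (m + i)) One)"] that by (force simp: F_def u_def v'_at)
  have zero: "u i = 0 \<longleftrightarrow> rs ! i = zer" if "i < n" for i
    using w[of "Eq (Var (m + i)) Zero"] that by (force simp: F_def u_def v'_at)
  have sign: "0 \<le> tm_val int_struct (w(x := u i)) s \<longleftrightarrow> zer \<le>. tm_val M (v(x := rs ! i)) s"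
    if "i < n" "s \<in> S" for i s
  proof -
    have "Le Zero (tsubst x (Var (m + i)) s) \<in> F" using that by (force simp: F_def)
    from w[OF this] show ?thesis using that by (simp add: u_def v'_at v'_tm)
  qed
  have fm: "sat int_struct (w(x := u i)) p \<longleftrightarrow> sat M (v(x := rs ! i)) p" if "i < n" for i
  proof -
    have "fsubst x (Var (m + i)) p \<in> F" using that by (force simp: F_def)
    from w[OF this] show ?thesis using that p by (simp add: u_def v'_at v'_fm)
  qed
  obtain y where y: "0 \<le> y" "sat int_struct (w(x := y)) p" using ex by blast
  have "\<exists>i<n. \<forall>t\<in>atoms p. 0 \<le> tm_val int_struct (w(x := y)) t \<longleftrightarrow> 0 \<le> tm_val int_struct (w(x := u i)) t"
  proof -
    define L where "L = {i. i < n \<and> u i \<le> y}"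
    have "zer \<in> set rs" by (simp add: rs)
    then obtain z where "z < n" "rs ! z = zer" by (auto simp: in_set_conv_nth n_def)
    then have "z \<in> L" using zero[of z] y(1) by (simp add: L_def)
    then have "L \<noteq> {}" "finite L" by (auto simp: L_def)
    then have "Max (u ` L) \<in> u ` L" by simp
    then obtain i where "i \<in> L" "u i = Max (u ` L)" by force
    then have i: "i < n" "u i \<le> y" "\<And>k. k < n \<Longrightarrow> u k \<le> y \<Longrightarrow> u k \<le> u i"
      using \<open>finite L\<close> by (auto simp: L_def)
    show ?thesis
    proof (cases "rs ! i +. uno \<in> set rs")
      case True
      then obtain k where "k < n" "rs ! k = rs ! i +. uno" by (auto simp: in_set_conv_nth n_def)
      \<comment> \<open>The copy of the successor is \<open>u i + 1\<close>; by maximality of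
        \<open>u i\<close> it exceeds \<open>y\<close>.\<close>
      then have "y = u i" using succ[of i k] i(1,2) i(3)[of k] by force
      then show ?thesis using i by auto
    next
      case False
      then have "rs ! i \<notin> C" by (auto simp: rs)
      \<comment> \<open>As \<open>rs ! i\<close> is no change, a change at or above it is a later
        sample point, copied beyond \<open>y\<close>.\<close>
      have above: "\<exists>k<n. c = rs ! k \<and> y < u k" if c: "c \<in> C" "rs ! i \<le>. c" for c
      proof -
        have "c \<in> set rs" using c by (simp add: rs)
        then obtain k where k: "k < n" "c = rs ! k" by (auto simp: in_set_conv_nth n_def)
        have "\<not> rs ! k \<le>. rs ! i"
        proof
          assume "rs ! k \<le>. rs ! i"
          then have "rs ! k = rs ! i"
            using c(2) k nonneg[of i] nonneg[of k] i(1) by (intro le_antisym) auto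
          then show False using c(1) k(2) \<open>rs ! i \<notin> C\<close> by simp
        qed
        then have "\<not> u k \<le> u i" using le i(1) k(1) by blast
        then have "y < u k" using i(3)[of k] k(1) by linarith
        then show ?thesis using k by blast
      qed
      define val where "val t = (\<lambda>y. tm_val int_struct (w(x := y)) t)" for t
      have val_diff: "(\<Delta> ^^ j) (val t) b = tm_val int_struct (w(x := b)) ((fdiff x ^^ j) t)" for j t b
        by (simp add: val_def tm_val_fdiff_pow)
      have val_zero: "(\<Delta> ^^ tdeg t) (val t) = (\<lambda>_. 0)" for t
        unfolding val_def by (rule \<Delta>_pow_tdeg)
      have "0 \<le> val t y \<longleftrightarrow> 0 \<le> val t (u i)" if t: "t \<in> atoms p" for t
      proof (cases "\<exists>j<n. y < u j")
        case True
        define U where "U = {j. j < n \<and> y < u j}"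
        have "U \<noteq> {}" "finite U" using True by (auto simp: U_def)
        then have "Min (u ` U) \<in> u ` U" by simp
        then obtain j where "j \<in> U" "u j = Min (u ` U)" by force
        then have j: "j < n" "y < u j" "\<And>k. k < n \<Longrightarrow> y < u k \<Longrightarrow> u j \<le> u k"
          using \<open>finite U\<close> by (auto simp: U_def)
        \<comment> \<open>No change lies from \<open>rs ! i\<close> up to but excluding
          \<open>rs ! j\<close>, so the signs at both ends agree in \<open>M\<close> and therefore
          at their copies.\<close>
        have const: "0 \<le> tm_val int_struct (w(x := u i)) s \<longleftrightarrow> 0 \<le> tm_val int_struct (w(x := u j)) s"
          if s: "s \<in> S" for s
        proof -
          have "sat M (v(x := rs ! j)) (Le Zero s) \<longleftrightarrow> sat M (v(x := rs ! i)) (Le Zero s)"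
          proof (rule sign_constant[OF v])
            show "rs ! i \<le>. rs ! j" using le[of i j] i j by simp
            fix c assume "c \<in> changes M v x s" "rs ! i \<le>. c"
            then obtain k where "k < n" "c = rs ! k" "y < u k"
              using above[of c] s by (auto simp: C_def)
            then show "rs ! j \<le>. c" using j le by blast
          qed (use nonneg i j in auto)
          then show ?thesis using sign i j s by simp
        qed
        show ?thesis
        proof (rule \<Delta>_sign_interval[OF val_zero])
          fix k assume "k \<le> tdeg t"
          then have "(fdiff x ^^ k) t \<in> S" using G t by (simp add: S_def)
          then show "0 \<le> (\<Delta> ^^ k) (val t) (u i) \<longleftrightarrow> 0 \<le> (\<Delta> ^^ k) (val t) (u j)"
            unfolding val_diff by (rule const)
        qed (use i j in auto)
      next
        case False
        have "sgn (val t y) = sgn (val t (u i))"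
        proof (rule \<Delta>_sign_tail[OF val_zero _ _ i(2)])
          fix k assume k: "k < tdeg t"
          define s where "s = (fdiff x ^^ k) t"
          have "s \<in> G" "fdiff x s \<in> G"
            using G[OF t, of k] G[OF t, of "Suc k"] k by (auto simp: s_def)
          then have S: "s \<in> S" "fdiff x s \<in> S" "Sub Zero s \<in> S" "Sub Zero (fdiff x s) \<in> S"
            by (auto simp: S_def)
          \<comment> \<open>No copied point exceeds \<open>y\<close>, so by \<open>above\<close> no
            change lies at or beyond \<open>rs ! i\<close>.\<close>
          have "\<not> rs ! i \<le>. c" if "r \<in> {s, Sub Zero s, fdiff x s, Sub Zero (fdiff x s)}"
            "c \<in> changes M v x r" for r c
            using that above[of c] S False by (auto simp: C_def)
          note tail = tail_sign[OF v _ _ this]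
          have sgn: "0 < tm_val int_struct (w(x := u i)) r \<longleftrightarrow>
                       \<not> sat M (v(x := rs ! i)) (Le Zero (Sub Zero r))"
                    "tm_val int_struct (w(x := u i)) r < 0 \<longleftrightarrow>
                       \<not> sat M (v(x := rs ! i)) (Le Zero r)"
            if "r \<in> S" "Sub Zero r \<in> S" for r
            using sign[OF i(1) that(1)] sign[OF i(1) that(2)] by auto
          have *: "(fdiff x ^^ Suc k) t = fdiff x s" by (simp add: s_def)
          show "0 < (\<Delta> ^^ Suc k) (val t) (u i) \<Longrightarrow> 0 < (\<Delta> ^^ k) (val t) (u i)"
            unfolding val_diff * s_def[symmetric]
            unfolding sgn(1)[OF S(2,4)] sgn(1)[OF S(1,3)]
            by (rule tail(1)) (use nonneg[OF i(1)] in auto)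
          show "(\<Delta> ^^ Suc k) (val t) (u i) < 0 \<Longrightarrow> (\<Delta> ^^ k) (val t) (u i) < 0"
            unfolding val_diff * s_def[symmetric]
            unfolding sgn(2)[OF S(2,4)] sgn(2)[OF S(1,3)]
            by (rule tail(2)) (use nonneg[OF i(1)] in auto)
        qed
        then show ?thesis by (auto simp: sgn_if split: if_splits)
      qed
      then show ?thesis using i(1) by (auto simp: val_def)
    qed
  qed
  then obtain i where i: "i < n" "sat int_struct (w(x := u i)) p"
    using sat_int_atoms_cong[OF p] y(2) by metis
  then show ?thesis using fm nonneg by blast
qed

text \<open>A solution \<open>y\<close> of any sign becomes the non-negative solution
  \<open>\<bar>y\<bar>\<close> of the disjunction of \<open>p\<close> with its reflection in
  \<open>x\<close>.\<close>

lemma (in dioph_open_induction) exists_transfer: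
  assumes p: "open_fm p" and v: "range v \<subseteq> carrier M"
    and ex: "\<And>w. \<exists>y. sat int_struct (w(x := y)) p"
  shows "\<exists>a\<in>carrier M. sat M (v(x := a)) p"
proof -
  let ?q = "Disj p (fsubst x (Sub Zero (Var x)) p)"
  have "\<exists>y\<ge>0. sat int_struct (w(x := y)) ?q" for w
  proof -
    obtain y where y: "sat int_struct (w(x := y)) p" using ex by blast
    show ?thesis
      by (rule exI[of _ "\<bar>y\<bar>"]) (use p y in \<open>simp add: abs_if\<close>)
  qed
  then obtain a where a: "a \<in> carrier M" "sat M (v(x := a)) ?q"
    using exists_nonneg_transfer[OF _ v, of ?q x] p by auto
  then show ?thesis
    using p closed(4)[OF closed(1) a(1)] by auto
qed

theorem theorem1p1:
  fixes M :: "'a oring_struct"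
  assumes "is_structure M"
  shows "is_model M T \<longleftrightarrow> model_DOI M"
proof
  assume "is_model M T"
  with assms show "model_DOI M" by (rule is_model_T_imp_DOI)
next
  assume DOI: "model_DOI M"
  interpret dioph_open_induction M
    using assms DOI
    by unfold_locales (auto simp: model_DOI_def model_OI_def diophantine_correct_iff)
  show "is_model M T"
    unfolding is_model_T_iff
  proof (intro allI impI, elim conjE)
    fix y p assume "open_fm p" "true_in int_struct (Exists y p)"
    then show "true_in M (Exists y p)"
      using exists_transfer[of p _ y] by (simp add: true_in_def)
  qed
qed

end
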